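(* Let $G$ be a bridgeless graph with $n$ vertices and $p$ blocks. Then the oriented diameter of $G$ satisfies \[\overrightarrow{\mathrm{diam}}(G) \leq n - \left\lfloor \frac{p}{2} \right\rfloor.\]
   Context: All graphs are finite and simple. A graph is bridgeless if it is connected and has no bridge (an edge whose removal disconnects the graph). A block of $G$ is a maximal connected subgraph of $G$ that has no cut vertex. An orientation of $G$ assigns a direction to each edge; it is strong if the resulting digraph is strongly connected. The diameter of a strong digraph is the maximum over ordered pairs $(u,v)$ of the directed distance from $u$ to $v$. The oriented diameter $\overrightarrow{\mathrm{diam}}(G)$ is the minimum diameter over all strong orientations of $G$ (which exist for bridgeless graphs by Robbins' theorem). *)

theory Defs
  imports "Graph_Theory.Graph_Theory"
begin

text \<open>A finite simple graph is a \<^locale>\<open>graph\<close> of the library: an undirected edge \<open>{u,v}\<close> is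
  the pair of opposite arcs from \<open>u\<close> to \<open>v\<close> and from \<open>v\<close> to \<open>u\<close>.
  Deleting an edge therefore deletes both arcs.\<close>

definition del_edge :: "('a,'b) pre_digraph \<Rightarrow> 'a \<Rightarrow> 'a \<Rightarrow> ('a,'b) pre_digraph" where
  "del_edge G u v = G\<lparr>arcs := {a \<in> arcs G. arc_to_ends G a \<notin> {(u, v), (v, u)}}\<rparr>"

definition bridge :: "('a,'b) pre_digraph \<Rightarrow> 'a \<Rightarrow> 'a \<Rightarrow> bool" where
  "bridge G u v \<longleftrightarrow> u \<rightarrow>\<^bsub>G\<^esub> v \<and> \<not> connected (del_edge G u v)"

definition bridgeless :: "('a,'b) pre_digraph \<Rightarrow> bool" where
  "bridgeless G \<longleftrightarrow> connected G \<and> (\<forall>u v. \<not> bridge G u v)"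

text \<open>Meant for connected graphs. The library's \<^const>\<open>connected\<close> is false for the graph without
  vertices, so the middle condition is what keeps the vertex of the one-vertex graph from being
  a cut vertex.\<close>

definition cut_vertex :: "('a,'b) pre_digraph \<Rightarrow> 'a \<Rightarrow> bool" where
  "cut_vertex G v \<longleftrightarrow> v \<in> verts G \<and> verts (pre_digraph.del_vert G v) \<noteq> {}
     \<and> \<not> connected (pre_digraph.del_vert G v)"

text \<open>Subgraphs of a symmetric digraph in the sense of \<^const>\<open>subgraph\<close> may contain just one arc
  of an edge; \<^const>\<open>symmetric\<close> singles out the undirected subgraphs.\<close>

definition blocks :: "('a,'b) pre_digraph \<Rightarrow> ('a,'b) pre_digraph set" where
  "blocks G = {B. pre_digraph.max_subgraph G
     (\<lambda>H. symmetric H \<and> connected H \<and> (\<forall>v. \<not> cut_vertex H v)) B}"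

definition orientation :: "('a,'b) pre_digraph \<Rightarrow> ('a,'b) pre_digraph \<Rightarrow> bool" where
  "orientation D G \<longleftrightarrow> spanning D G \<and>
     (\<forall>u v. u \<rightarrow>\<^bsub>G\<^esub> v \<longrightarrow> (u \<rightarrow>\<^bsub>D\<^esub> v) \<noteq> (v \<rightarrow>\<^bsub>D\<^esub> u))"

text \<open>With unit weights, the library's \<open>\<mu>\<close> is the least length of a directed walk, i.e. the
  directed distance (\<open>\<infinity>\<close> if there is no walk).\<close>

definition diameter :: "('a,'b) pre_digraph \<Rightarrow> ereal" where
  "diameter D = (SUP (u, v) \<in> verts D \<times> verts D. wf_digraph.\<mu> D (\<lambda>_. 1) u v)"

text \<open>The diameters involved are natural numbers, so the infimum is a minimum whenever a strong
  orientation exists; it is \<open>\<infinity>\<close> otherwise.\<close>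

definition oriented_diameter :: "('a,'b) pre_digraph \<Rightarrow> ereal" where
  "oriented_diameter G = (INF D \<in> {D. orientation D G \<and> strongly_connected D}. diameter D)"

end

theory Submission
  imports Defs
begin

text \<open>
  In every bridgeless graph with at least three vertices, two distinct vertices have distance at
  most \<open>n - 2\<close>, and directing a shortest path between them extends to a strong orientation. So each
  block that a directed path traverses between two different cut vertices can be oriented to spare
  the path one vertex in a direction of our choice; alternating the choices along a chain
  of blocks spares every path about half a vertex per block. A block that the path does not
  meet spares at least two vertices. Splitting at cut vertices, an induction balances
  the two effects: either a root sits at the end of a chain, where directions alternate, or the graph
  branches and some branch is avoided entirely.
\<close>

section \<open>Strongly connected relations\<close>

definition strong :: "'a set \<Rightarrow> 'a rel \<Rightarrow> bool" where
  "strong W M \<longleftrightarrow> (\<forall>u\<in>W. \<forall>v\<in>W. (u, v) \<in> rtrancl_on W M)"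

text \<open>An edge crosses a cut with only one of its two arcs in a given direction, so for symmetric
  relations this is 2-edge-connectedness.\<close>

definition two_arc_strong :: "'a set \<Rightarrow> 'a rel \<Rightarrow> bool" where
  "two_arc_strong W M \<longleftrightarrow> (\<forall>e. strong W (M - {e}))"

lemma strong_crossing_arcE:
  assumes "strong W M" "S \<noteq> {}" "S \<subset> W"
  obtains a b where "a \<in> S" "b \<in> W - S" "(a, b) \<in> M"
proof -
  obtain u v where "u \<in> S" "v \<in> W - S" using assms(2,3) by blast
  then have "(u, v) \<in> rtrancl_on W M" using assms(1,3) unfolding strong_def by blast
  then have "v \<in> S" if "\<And>a b. a \<in> S \<Longrightarrow> b \<in> W - S \<Longrightarrow> (a, b) \<notin> M"
    by (induction rule: rtrancl_on_induct) (use that \<open>u \<in> S\<close> in blast)+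
  then show thesis using that \<open>v \<in> W - S\<close> by blast
qed

lemma not_strongE:
  assumes "\<not> strong W M"
  obtains S where "S \<noteq> {}" "S \<subset> W" "M \<inter> S \<times> (W - S) = {}"
proof -
  obtain u v where uv: "u \<in> W" "v \<in> W" "(u, v) \<notin> rtrancl_on W M"
    using assms unfolding strong_def by blast
  let ?S = "{w \<in> W. (u, w) \<in> rtrancl_on W M}"
  have "u \<in> ?S" "v \<notin> ?S" using uv by auto
  then have "?S \<noteq> {}" "?S \<subset> W" using \<open>v \<in> W\<close> by blast+
  then show thesis
    by (rule that) (auto intro: rtrancl_on_into_rtrancl_on)
qed

lemma strong_mono:
  assumes "strong W M" "Restr M W \<subseteq> M'"
  shows "strong W M'"
proof (rule ccontr)
  assume "\<not> strong W M'"
  then obtain S where S: "S \<noteq> {}" "S \<subset> W" "M' \<inter> S \<times> (W - S) = {}"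
    by (rule not_strongE)
  obtain a b where "a \<in> S" "b \<in> W - S" "(a, b) \<in> M"
    using strong_crossing_arcE[OF assms(1) S(1,2)] .
  then show False using S assms(2) by blast
qed

lemma strong_cong:
  "Restr M W = Restr M' W \<Longrightarrow> strong W M \<longleftrightarrow> strong W M'"
  using strong_mono[of W M M'] strong_mono[of W M' M] by blast

lemma strong_Restr: "strong W (Restr M W) \<longleftrightarrow> strong W M"
  by (rule strong_cong) blast

lemma two_arc_strong_imp_strong: "two_arc_strong W M \<Longrightarrow> strong W M"
  unfolding two_arc_strong_def by (meson Diff_subset inf.coboundedI1 strong_mono)

lemma two_arc_strong_crossing_arcE:
  assumes "two_arc_strong W M" "S \<noteq> {}" "S \<subset> W"
  obtains a b where "a \<in> S" "b \<in> W - S" "(a, b) \<in> M" "(a, b) \<noteq> e"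
proof -
  have "strong W (M - {e})" using assms(1) unfolding two_arc_strong_def by blast
  then show thesis
    by (rule strong_crossing_arcE[OF _ assms(2,3)]) (use that in auto)
qed

lemma two_arc_strong_card_ge_3:
  assumes "two_arc_strong W M" "card W \<ge> 2"
  shows "card W \<ge> 3"
proof -
  have "card W \<noteq> 2"
  proof
    assume "card W = 2"
    then obtain a b where W: "W = {a, b}" "a \<noteq> b" by (auto simp: card_2_iff)
    then show False
      using two_arc_strong_crossing_arcE[OF assms(1), of "{a}" "(a, b)"] by auto
  qed
  then show ?thesis using assms(2) by linarith
qed

section \<open>Strong orientations\<close>

definition orients :: "'a set \<Rightarrow> 'a rel \<Rightarrow> 'a rel \<Rightarrow> bool" where
  "orients W E M \<longleftrightarrow> M \<subseteq> Restr E W \<and> (\<forall>(u, v)\<in>Restr E W. ((u, v) \<in> M) \<noteq> ((v, u) \<in> M))"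

text \<open>If both removals fail, the two sets witnessing this have no arc leaving their
  intersection or their union, so they are complementary and \<open>E\<close> crosses the cut only in \<open>(u, v)\<close>.\<close>

lemma strong_remove_arc_or_converse:
  assumes E: "two_arc_strong W E" and M: "strong W M" "Restr E W \<subseteq> M \<union> M\<inverse>"
  shows "strong W (M - {(u, v)}) \<or> strong W (M - {(v, u)})"
proof (rule ccontr)
  assume "\<not> ?thesis"
  then have not_strong: "\<not> strong W (M - {(u, v)})" "\<not> strong W (M - {(v, u)})" by blast+
  obtain S where S: "S \<noteq> {}" "S \<subset> W" "(M - {(u, v)}) \<inter> S \<times> (W - S) = {}"
    using not_strong(1) by (rule not_strongE)
  obtain T where T: "T \<noteq> {}" "T \<subset> W" "(M - {(v, u)}) \<inter> T \<times> (W - T) = {}"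
    using not_strong(2) by (rule not_strongE)
  obtain a b where "a \<in> S" "b \<in> W - S" "(a, b) \<in> M"
    using strong_crossing_arcE[OF M(1) S(1,2)] .
  then have uv_S: "u \<in> S" "v \<in> W - S" using S(3) by auto
  obtain a b where "a \<in> T" "b \<in> W - T" "(a, b) \<in> M"
    using strong_crossing_arcE[OF M(1) T(1,2)] .
  then have uv_T: "v \<in> T" "u \<in> W - T" using T(3) by auto
  have "S \<inter> T = {}"
  proof (rule ccontr)
    assume "S \<inter> T \<noteq> {}"
    moreover have "S \<inter> T \<subset> W" using S(2) by blast
    ultimately obtain a b where "a \<in> S \<inter> T" "b \<in> W - S \<inter> T" "(a, b) \<in> M"
      by (rule strong_crossing_arcE[OF M(1)])
    then show False using S(3) T(3) uv_S uv_T by auto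
  qed
  moreover have "S \<union> T = W"
  proof (rule ccontr)
    assume "S \<union> T \<noteq> W"
    then have "S \<union> T \<noteq> {}" "S \<union> T \<subset> W" using S T by auto
    then obtain a b where "a \<in> S \<union> T" "b \<in> W - (S \<union> T)" "(a, b) \<in> M"
      by (rule strong_crossing_arcE[OF M(1)])
    then show False using S(3) T(3) uv_S uv_T by auto
  qed
  ultimately have complementary: "T = W - S" by blast
  obtain a b where ab: "a \<in> S" "b \<in> W - S" "(a, b) \<in> E" "(a, b) \<noteq> (u, v)"
    using two_arc_strong_crossing_arcE[OF E S(1,2)] .
  then have "(a, b) \<in> M \<or> (b, a) \<in> M" using M(2) S(2) by blast
  then show False using S(3) T(3) ab complementary S(2) by auto
qed

lemma exists_strong_suborientation:
  assumes E: "two_arc_strong W E" "irrefl E" and "finite W"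
    and M: "strong W M" "M \<subseteq> Restr E W" "Restr E W \<subseteq> M \<union> M\<inverse>"
  obtains M' where "M' \<subseteq> M" "orients W E M'" "strong W M'"
proof -
  let ?\<A> = "{M'. M' \<subseteq> M \<and> strong W M' \<and> Restr E W \<subseteq> M' \<union> M'\<inverse>}"
  have "finite M"
    using M(2) \<open>finite W\<close> by (meson finite_Int finite_SigmaI finite_subset)
  moreover have "?\<A> \<subseteq> Pow M" by blast
  ultimately have "finite ?\<A>" by (meson finite_Pow_iff finite_subset)
  moreover have "M \<in> ?\<A>" using M by simp
  ultimately obtain M' where "M' \<in> ?\<A>" and minimal: "\<forall>M''\<in>?\<A>. M'' \<subseteq> M' \<longrightarrow> M' = M''"
    by (auto dest: finite_has_minimal2)
  then have M': "M' \<subseteq> M" "strong W M'" "Restr E W \<subseteq> M' \<union> M'\<inverse>" by simp_all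
  have irremovable: "\<not> strong W (M' - {(u, v)})" if uv: "(u, v) \<in> M'" "(v, u) \<in> M'" for u v
  proof
    assume "strong W (M' - {(u, v)})"
    moreover have "u \<noteq> v" using uv M' M(2) E(2) by (auto simp: irrefl_def)
    then have "Restr E W \<subseteq> (M' - {(u, v)}) \<union> (M' - {(u, v)})\<inverse>" using uv M'(3) by blast
    ultimately have "M' - {(u, v)} \<in> ?\<A>" using M'(1) by blast
    then have "M' = M' - {(u, v)}" by (rule minimal[rule_format]) blast
    then show False using uv(1) by blast
  qed
  have "(u, v) \<notin> M' \<or> (v, u) \<notin> M'" for u v
    using strong_remove_arc_or_converse[OF E(1) M'(2,3), of u v]
      irremovable[of u v] irremovable[of v u] by blast
  then have "orients W E M'"
    using M' M(2) unfolding orients_def by auto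
  then show thesis using that M' by blast
qed

section \<open>Shortest paths\<close>

definition shortest_path :: "'a rel \<Rightarrow> nat \<Rightarrow> (nat \<Rightarrow> 'a) \<Rightarrow> bool" where
  "shortest_path R k f \<longleftrightarrow>
     (\<forall>i<k. (f i, f (Suc i)) \<in> R) \<and> (\<forall>j. (f 0, f k) \<in> R ^^ j \<longrightarrow> k \<le> j)"

lemma shortest_path_arc: "shortest_path R k f \<Longrightarrow> i < k \<Longrightarrow> (f i, f (Suc i)) \<in> R"
  unfolding shortest_path_def by blast

lemma exists_shortest_path:
  assumes "(u, v) \<in> R\<^sup>*"
  obtains k f where "shortest_path R k f" "f 0 = u" "f k = v"
proof -
  define k where "k = (LEAST j. (u, v) \<in> R ^^ j)"
  have "\<exists>j. (u, v) \<in> R ^^ j" using assms by (rule rtrancl_imp_relpow)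
  then have "(u, v) \<in> R ^^ k" unfolding k_def by (rule LeastI_ex)
  then obtain f where "f 0 = u" "f k = v" "\<forall>i<k. (f i, f (Suc i)) \<in> R"
    unfolding relpow_fun_conv by blast
  then show thesis
    by (intro that[of k f]) (auto simp: shortest_path_def k_def intro: Least_le)
qed

lemma shortest_path_no_shortcut:
  assumes "shortest_path R k f" "i \<le> k" "j \<le> k" "(f i, f j) \<in> R ^^ d"
  shows "j \<le> i + d"
proof -
  have segment: "(f a, f b) \<in> R ^^ (b - a)" if "a \<le> b" "b \<le> k" for a b
    unfolding relpow_fun_conv
    by (rule exI[of _ "\<lambda>m. f (a + m)"]) (use shortest_path_arc[OF assms(1)] that in auto)
  have "(f 0, f i) \<in> R ^^ i" "(f j, f k) \<in> R ^^ (k - j)"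
    using segment[of 0 i] segment[of j k] assms(2,3) by auto
  then have "(f 0, f k) \<in> R ^^ (i + d + (k - j))" using assms(4) by (blast intro: relpow_trans)
  then have "k \<le> i + d + (k - j)" using assms(1) unfolding shortest_path_def by blast
  then show ?thesis using assms(3) by linarith
qed

lemma shortest_path_inj:
  assumes "shortest_path R k f"
  shows "inj_on f {..k}"
proof (rule inj_onI)
  fix i j assume "i \<in> {..k}" "j \<in> {..k}" "f i = f j"
  then show "i = j"
    using shortest_path_no_shortcut[OF assms, of i j 0] shortest_path_no_shortcut[OF assms, of j i 0]
    by simp
qed

lemma shortest_path_image_subset:
  assumes "shortest_path R k f" "R \<subseteq> W \<times> W" "f 0 \<in> W"
  shows "f ` {..k} \<subseteq> W"
proof clarify
  fix i assume "i \<le> k"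
  then show "f i \<in> W"
  proof (cases i)
    case (Suc j)
    then show ?thesis using shortest_path_arc[OF assms(1), of j] \<open>i \<le> k\<close> assms(2) by auto
  qed (use assms(3) in simp)
qed

lemma shortest_path_length_less:
  assumes "shortest_path R k f" "R \<subseteq> W \<times> W" "f 0 \<in> W" "finite W"
  shows "k < card W"
proof -
  have "card (f ` {..k}) \<le> card W"
    using assms shortest_path_image_subset by (metis card_mono)
  then show ?thesis using card_image[OF shortest_path_inj[OF assms(1)]] by simp
qed

text \<open>A Hamiltonian shortest path could be shortened by a second arc into its last vertex.\<close>

lemma shortest_path_not_Hamiltonian:
  assumes E: "two_arc_strong W E" and path: "shortest_path (Restr E W) k f"
    and "f 0 \<in> W" "finite W" "0 < k"
  shows "k + 1 < card W"
proof (rule ccontr)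
  assume "\<not> k + 1 < card W"
  have image: "f ` {..k} \<subseteq> W"
    using shortest_path_image_subset[OF path] \<open>f 0 \<in> W\<close> by blast
  moreover have "card (f ` {..k}) = k + 1"
    using card_image[OF shortest_path_inj[OF path]] by simp
  ultimately have Hamiltonian: "f ` {..k} = W"
    using \<open>\<not> k + 1 < card W\<close> \<open>finite W\<close> by (intro card_seteq) auto
  have "f 0 \<noteq> f k" using shortest_path_inj[OF path] \<open>0 < k\<close> by (auto dest: inj_onD)
  then have "W - {f k} \<noteq> {}" "W - {f k} \<subset> W" using image by auto
  then obtain a b where ab: "a \<in> W - {f k}" "b \<in> W - (W - {f k})" "(a, b) \<in> E"
      "(a, b) \<noteq> (f (k - 1), f k)"
    by (rule two_arc_strong_crossing_arcE[OF E])
  then have "b = f k" by blast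
  obtain i where i: "i \<le> k" "a = f i" using ab(1) Hamiltonian by blast
  then have "i \<noteq> k" "i \<noteq> k - 1" using ab \<open>b = f k\<close> by auto
  moreover have "k \<le> i + 1"
    using shortest_path_no_shortcut[OF path i(1) order_refl, of 1] i ab image by auto
  ultimately show False using i by linarith
qed

lemma sequence_leaves_set:
  assumes "f i \<in> S" "f j \<notin> S" "i \<le> j"
  obtains m where "i \<le> m" "m < j" "f m \<in> S" "f (Suc m) \<notin> S"
proof -
  have "\<exists>m. i \<le> m \<and> m < j \<and> f m \<in> S \<and> f (Suc m) \<notin> S"
    using \<open>i \<le> j\<close> \<open>f j \<notin> S\<close>
  proof (induction j rule: dec_induct)
    case base
    then show ?case using \<open>f i \<in> S\<close> by blast
  next
    case (step j)
    then show ?case by (cases "f j \<in> S") (auto intro: less_SucI)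
  qed
  then show thesis using that by blast
qed

text \<open>If a set is left only through reversed path arcs, then the path enters it twice and leaves it in
  between.\<close>

lemma shortest_path_strong_remove_converse:
  assumes E: "two_arc_strong W E" and path: "shortest_path (Restr E W) k f"
  defines "M \<equiv> Restr E W - {(f (Suc i), f i) | i. i < k}"
  shows "strong W M" "\<And>i. i < k \<Longrightarrow> (f i, f (Suc i)) \<in> M"
proof -
  show path_M: "(f i, f (Suc i)) \<in> M" if "i < k" for i
  proof -
    have "\<not> (f i = f (Suc j) \<and> f (Suc i) = f j)" if "j < k" for j
      using inj_onD[OF shortest_path_inj[OF path], of i "Suc j"]
        inj_onD[OF shortest_path_inj[OF path], of "Suc i" j] \<open>i < k\<close> that by force
    then show ?thesis using shortest_path_arc[OF path that] unfolding M_def by blast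
  qed
  show "strong W M"
  proof (rule ccontr)
    assume "\<not> strong W M"
    then obtain S where S: "S \<noteq> {}" "S \<subset> W" "M \<inter> S \<times> (W - S) = {}"
      by (rule not_strongE)
    have reversed: "\<exists>i<k. f (Suc i) \<in> S \<and> f i \<in> W - S \<and> (f (Suc i), f i) \<noteq> e" for e
    proof -
      obtain a b where ab: "a \<in> S" "b \<in> W - S" "(a, b) \<in> E" "(a, b) \<noteq> e"
        using two_arc_strong_crossing_arcE[OF E S(1,2)] .
      moreover have "(a, b) \<in> Restr E W - M" using ab S by blast
      ultimately show ?thesis unfolding M_def by blast
    qed
    obtain i where i: "i < k" "f (Suc i) \<in> S" "f i \<in> W - S" using reversed by blast
    obtain j where j: "j < k" "f (Suc j) \<in> S" "f j \<in> W - S" "j \<noteq> i"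
      using reversed[of "(f (Suc i), f i)"] by blast
    have no_entry: "\<not> i < j" if ij: "f (Suc i) \<in> S" "f j \<in> W - S" "j < k" for i j
    proof
      assume "i < j"
      then obtain m where m: "m < j" "f m \<in> S" "f (Suc m) \<notin> S"
        using sequence_leaves_set[of f "Suc i" S j] ij by auto
      then have "(f m, f (Suc m)) \<in> M" using path_M \<open>j < k\<close> by simp
      moreover have "f (Suc m) \<in> W" using calculation unfolding M_def by blast
      ultimately show False using S(3) m by blast
    qed
    show False using no_entry[of i j] no_entry[of j i] i j by linarith
  qed
qed

section \<open>Spared vertices\<close>

text \<open>With \<open>n\<close> the number of vertices, a path of length \<open>j\<close> avoids at least \<open>n - j - 1\<close> of them.
  Counting avoided vertices makes the bounds additive under gluing at a cut vertex.\<close>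

definition spare :: "'a rel \<Rightarrow> nat \<Rightarrow> nat \<Rightarrow> 'a set \<Rightarrow> 'a set \<Rightarrow> bool" where
  "spare M n k A B \<longleftrightarrow> (\<forall>u\<in>A. \<forall>v\<in>B. \<exists>j. (u, v) \<in> M ^^ j \<and> j + k < n)"

lemma relpow_mono: "(R :: 'a rel) \<subseteq> S \<Longrightarrow> R ^^ n \<subseteq> S ^^ n"
  by (induction n) (auto simp: relcomp_mono)

lemma spare_mono:
  assumes "spare M n k A B" "M \<subseteq> M'" "A' \<subseteq> A" "B' \<subseteq> B" "k' + n \<le> k + n'"
  shows "spare M' n' k' A' B'"
  unfolding spare_def
proof (intro ballI)
  fix u v assume "u \<in> A'" "v \<in> B'"
  then obtain j where "(u, v) \<in> M ^^ j" "j + k < n" using assms unfolding spare_def by blast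
  then show "\<exists>j. (u, v) \<in> M' ^^ j \<and> j + k' < n'"
    using relpow_mono[OF assms(2), of j] assms(5) by (intro exI[of _ j]) auto
qed

lemma spare_weaken:
  "spare M n k A B \<Longrightarrow> k' \<le> k \<Longrightarrow> A' \<subseteq> A \<Longrightarrow> B' \<subseteq> B \<Longrightarrow> spare M n k' A' B'"
  by (erule spare_mono) auto

lemma spare_concat:
  assumes "spare M n\<^sub>1 k\<^sub>1 A {x}" "spare M n\<^sub>2 k\<^sub>2 {x} B"
  shows "spare M (n\<^sub>1 + n\<^sub>2 - 1) (k\<^sub>1 + k\<^sub>2) A B"
  unfolding spare_def
proof (intro ballI)
  fix u v assume "u \<in> A" "v \<in> B"
  then obtain i j where "(u, x) \<in> M ^^ i" "i + k\<^sub>1 < n\<^sub>1" "(x, v) \<in> M ^^ j" "j + k\<^sub>2 < n\<^sub>2"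
    using assms unfolding spare_def by blast
  then show "\<exists>j. (u, v) \<in> M ^^ j \<and> j + (k\<^sub>1 + k\<^sub>2) < n\<^sub>1 + n\<^sub>2 - 1"
    by (intro exI[of _ "i + j"]) (auto intro: relpow_trans)
qed

lemma spare_singleton_self: "k < n \<Longrightarrow> spare M n k {x} {x}"
  unfolding spare_def by (auto intro: exI[of _ 0])

lemma strong_spare:
  assumes "strong W M" "M \<subseteq> W \<times> W" "finite W" "A \<subseteq> W" "B \<subseteq> W"
  shows "spare M (card W) 0 A B"
  unfolding spare_def
proof (intro ballI)
  fix u v assume "u \<in> A" "v \<in> B"
  then have uv: "u \<in> W" "v \<in> W" using assms(4,5) by auto
  then have "(u, v) \<in> M\<^sup>*"
    using assms(1) unfolding strong_def by (blast intro: rtrancl_on_rtranclI)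
  then obtain k f where path: "shortest_path M k f" "f 0 = u" "f k = v"
    by (rule exists_shortest_path)
  then have "(u, v) \<in> M ^^ k" unfolding relpow_fun_conv by (blast dest: shortest_path_arc)
  moreover have "k < card W" using shortest_path_length_less path assms(2,3) uv by blast
  ultimately show "\<exists>j. (u, v) \<in> M ^^ j \<and> j + 0 < card W" by auto
qed

lemma exists_strong_orientation:
  assumes E: "two_arc_strong W E" "irrefl E" and "finite W"
  obtains M where "orients W E M" "strong W M"
proof -
  have "strong W (Restr E W)" using two_arc_strong_imp_strong[OF E(1)] by (simp add: strong_Restr)
  then show thesis using exists_strong_suborientation[OF assms, of "Restr E W"] that by blast
qed

lemma exists_strong_orientation_spare:
  assumes E: "two_arc_strong W E" "irrefl E" and "finite W" and xy: "x \<in> W" "y \<in> W" "x \<noteq> y"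
  obtains M where "orients W E M" "strong W M" "spare M (card W) 1 {x} {y}"
proof -
  have "strong W (Restr E W)" using two_arc_strong_imp_strong[OF E(1)] by (simp add: strong_Restr)
  then have "(x, y) \<in> (Restr E W)\<^sup>*"
    using xy unfolding strong_def by (blast intro: rtrancl_on_rtranclI)
  then obtain k f where path: "shortest_path (Restr E W) k f" and ends: "f 0 = x" "f k = y"
    by (rule exists_shortest_path)
  have "0 < k" using ends \<open>x \<noteq> y\<close> by (cases k) auto
  then have length: "k + 1 < card W"
    using shortest_path_not_Hamiltonian[OF E(1) path] ends \<open>finite W\<close> \<open>x \<in> W\<close> by blast
  define N where "N = Restr E W - {(f (Suc i), f i) | i. i < k}"
  have N: "strong W N" "\<And>i. i < k \<Longrightarrow> (f i, f (Suc i)) \<in> N"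
    unfolding N_def by (fact shortest_path_strong_remove_converse[OF E(1) path])+
  have "N \<subseteq> Restr E W" "Restr E W \<subseteq> N \<union> N\<inverse>"
    using N(2) unfolding N_def by blast+
  then obtain M where M: "M \<subseteq> N" "orients W E M" "strong W M"
    using exists_strong_suborientation[OF assms(1-3) N(1)] by blast
  have "(f i, f (Suc i)) \<in> M" if "i < k" for i
  proof -
    have "(f (Suc i), f i) \<notin> M" using that M(1) unfolding N_def by blast
    then show ?thesis
      using M(2) shortest_path_arc[OF path that] unfolding orients_def by blast
  qed
  then have "(x, y) \<in> M ^^ k" using ends unfolding relpow_fun_conv by blast
  then show thesis using that M length unfolding spare_def by auto
qed

section \<open>Blocks and gluing\<close>

definition nonseparable :: "'a set \<Rightarrow> 'a rel \<Rightarrow> bool" where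
  "nonseparable U E \<longleftrightarrow> U \<noteq> {} \<and> strong U E \<and> (\<forall>v. strong (U - {v}) E)"

lemma nonseparable_mono:
  assumes "nonseparable U E" "Restr E U \<subseteq> E'"
  shows "nonseparable U E'"
proof -
  have "strong V E'" if "strong V E" "V \<subseteq> U" for V
    using that(1) by (rule strong_mono) (use that(2) assms(2) in auto)
  then show ?thesis using assms(1) unfolding nonseparable_def by auto
qed

definition block_sets :: "'a set \<Rightarrow> 'a rel \<Rightarrow> 'a set set" where
  "block_sets W E = {U. U \<subseteq> W \<and> nonseparable U E \<and>
     (\<forall>U'. U \<subseteq> U' \<and> U' \<subseteq> W \<and> nonseparable U' E \<longrightarrow> U' = U)}"

definition block_count :: "'a set \<Rightarrow> 'a rel \<Rightarrow> nat" where
  "block_count W E = card (block_sets W E)"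

definition glued :: "'a set \<Rightarrow> 'a rel \<Rightarrow> 'a \<Rightarrow> 'a set \<Rightarrow> 'a set \<Rightarrow> bool" where
  "glued W E x W\<^sub>1 W\<^sub>2 \<longleftrightarrow> W = W\<^sub>1 \<union> W\<^sub>2 \<and> W\<^sub>1 \<inter> W\<^sub>2 = {x} \<and> W\<^sub>1 \<noteq> {x} \<and> W\<^sub>2 \<noteq> {x} \<and>
     (\<forall>a\<in>W\<^sub>1 - {x}. \<forall>b\<in>W\<^sub>2 - {x}. (a, b) \<notin> E \<and> (b, a) \<notin> E)"

lemma glued_commute: "glued W E x W\<^sub>1 W\<^sub>2 \<Longrightarrow> glued W E x W\<^sub>2 W\<^sub>1"
  unfolding glued_def by blast

lemma glued_subset_rel: "glued W E x W\<^sub>1 W\<^sub>2 \<Longrightarrow> E' \<subseteq> E \<Longrightarrow> glued W E' x W\<^sub>1 W\<^sub>2"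
  unfolding glued_def by blast

lemma glued_card:
  assumes "glued W E x W\<^sub>1 W\<^sub>2" "finite W"
  shows "card W + 1 = card W\<^sub>1 + card W\<^sub>2" "finite W\<^sub>1" "card W\<^sub>1 \<ge> 2" "card W\<^sub>1 < card W"
proof -
  show fin: "finite W\<^sub>1" using assms unfolding glued_def by auto
  have "finite W\<^sub>2" using assms unfolding glued_def by auto
  show sum: "card W + 1 = card W\<^sub>1 + card W\<^sub>2"
    using card_Un_Int[OF fin \<open>finite W\<^sub>2\<close>] assms(1) unfolding glued_def by simp
  have "{x} \<subset> W\<^sub>1" "{x} \<subset> W\<^sub>2" using assms(1) unfolding glued_def by auto
  then have "card {x} < card W\<^sub>1" "card {x} < card W\<^sub>2"
    using psubset_card_mono[OF fin] psubset_card_mono[OF \<open>finite W\<^sub>2\<close>] by blast+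
  then have "1 < card W\<^sub>1" "1 < card W\<^sub>2" by simp_all
  then show "card W\<^sub>1 \<ge> 2" "card W\<^sub>1 < card W" using sum by linarith+
qed

lemma glued_not_adjacent:
  assumes "glued W E x W\<^sub>1 W\<^sub>2" "a \<in> W\<^sub>1 - {x}" "b \<in> W\<^sub>2 - {x}"
  shows "(a, b) \<notin> E" "(b, a) \<notin> E"
  using assms unfolding glued_def by simp_all

lemma glued_assoc:
  assumes glued: "glued W E x W\<^sub>1 W\<^sub>2" "glued W\<^sub>1 E y H\<^sub>1 H\<^sub>2" and "x \<in> H\<^sub>2"
  shows "glued W E y H\<^sub>1 (H\<^sub>2 \<union> W\<^sub>2)"
proof -
  have sets: "W = W\<^sub>1 \<union> W\<^sub>2" "W\<^sub>1 \<inter> W\<^sub>2 = {x}" "W\<^sub>1 = H\<^sub>1 \<union> H\<^sub>2" "H\<^sub>1 \<inter> H\<^sub>2 = {y}" "H\<^sub>1 \<noteq> {y}" "H\<^sub>2 \<noteq> {y}"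
    using glued unfolding glued_def by simp_all
  have not_adjacent: "(a, b) \<notin> E \<and> (b, a) \<notin> E" if "a \<in> H\<^sub>1 - {y}" "b \<in> H\<^sub>2 \<union> W\<^sub>2 - {y}" for a b
  proof (cases "b \<in> H\<^sub>2")
    case True
    then show ?thesis using glued_not_adjacent[OF glued(2)] that by auto
  next
    case False
    then have "a \<in> W\<^sub>1" "b \<in> W\<^sub>2 - {x}" using that sets(3) \<open>x \<in> H\<^sub>2\<close> by blast+
    moreover have "a \<noteq> x" using that(1) sets(4) \<open>x \<in> H\<^sub>2\<close> by blast
    ultimately have "a \<in> W\<^sub>1 - {x}" "b \<in> W\<^sub>2 - {x}" by blast+
    then show ?thesis using glued_not_adjacent[OF glued(1)] by auto
  qed
  have "H\<^sub>1 \<inter> W\<^sub>2 \<subseteq> H\<^sub>1 \<inter> H\<^sub>2" using sets(2,3) \<open>x \<in> H\<^sub>2\<close> by auto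
  then have "H\<^sub>1 \<inter> (H\<^sub>2 \<union> W\<^sub>2) = {y}" using sets(4) by blast
  moreover have "H\<^sub>2 \<union> W\<^sub>2 \<noteq> {y}" using sets(4,6) by auto
  moreover have "W = H\<^sub>1 \<union> (H\<^sub>2 \<union> W\<^sub>2)" using sets(1,3) by auto
  ultimately show ?thesis using sets(5) not_adjacent unfolding glued_def by simp
qed

lemma glued_strong:
  assumes glued: "glued W E x W\<^sub>1 W\<^sub>2" and "strong W E"
  shows "strong W\<^sub>1 E"
proof (rule ccontr)
  assume "\<not> strong W\<^sub>1 E"
  then obtain S where S: "S \<noteq> {}" "S \<subset> W\<^sub>1" "E \<inter> S \<times> (W\<^sub>1 - S) = {}" by (rule not_strongE)
  have W: "W = W\<^sub>1 \<union> W\<^sub>2" "W\<^sub>1 \<inter> W\<^sub>2 = {x}" using glued unfolding glued_def by simp_all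
  define T where "T = (if x \<in> S then S \<union> W\<^sub>2 else S)"
  have "T \<noteq> {}" "T \<subset> W" using S W unfolding T_def by auto
  then obtain a b where ab: "a \<in> T" "b \<in> W - T" "(a, b) \<in> E"
    by (rule strong_crossing_arcE[OF \<open>strong W E\<close>])
  have "a \<in> S \<and> b \<in> W\<^sub>1 - S \<or> a \<in> W\<^sub>2 - {x} \<and> b \<in> W\<^sub>1 - {x} \<or> a \<in> W\<^sub>1 - {x} \<and> b \<in> W\<^sub>2 - {x}"
    using ab S(2) W unfolding T_def by (auto split: if_splits)
  then show False using glued_not_adjacent[OF glued] ab(3) S(3) by blast
qed

lemma glued_two_arc_strong:
  "glued W E x W\<^sub>1 W\<^sub>2 \<Longrightarrow> two_arc_strong W E \<Longrightarrow> two_arc_strong W\<^sub>1 E"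
  unfolding two_arc_strong_def using glued_strong glued_subset_rel by (metis Diff_subset)

lemma glued_Restr:
  assumes glued: "glued W E x W\<^sub>1 W\<^sub>2"
  shows "Restr E W = Restr E W\<^sub>1 \<union> Restr E W\<^sub>2"
proof
  have W: "W = W\<^sub>1 \<union> W\<^sub>2" and x: "x \<in> W\<^sub>1" "x \<in> W\<^sub>2" using glued unfolding glued_def by auto
  then show "Restr E W\<^sub>1 \<union> Restr E W\<^sub>2 \<subseteq> Restr E W" by blast
  show "Restr E W \<subseteq> Restr E W\<^sub>1 \<union> Restr E W\<^sub>2"
  proof (rule subrelI, rule ccontr)
    fix u v assume uv: "(u, v) \<in> Restr E W" "(u, v) \<notin> Restr E W\<^sub>1 \<union> Restr E W\<^sub>2"
    then have "u \<in> W\<^sub>1 - {x} \<and> v \<in> W\<^sub>2 - {x} \<or> u \<in> W\<^sub>2 - {x} \<and> v \<in> W\<^sub>1 - {x}"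
      using W x by auto
    then show False using glued_not_adjacent[OF glued] uv(1) by blast
  qed
qed

lemma glued_orients:
  assumes glued: "glued W E x W\<^sub>1 W\<^sub>2" and "irrefl E" and M: "orients W\<^sub>1 E M\<^sub>1" "orients W\<^sub>2 E M\<^sub>2"
  shows "orients W E (M\<^sub>1 \<union> M\<^sub>2)"
proof -
  have "Restr E W\<^sub>1 \<inter> Restr E W\<^sub>2 = Restr E (W\<^sub>1 \<inter> W\<^sub>2)" by blast
  also have "\<dots> = {}" using glued \<open>irrefl E\<close> unfolding glued_def irrefl_def by auto
  finally have disjoint: "Restr E W\<^sub>1 \<inter> Restr E W\<^sub>2 = {}" .
  have M_sub: "M\<^sub>1 \<subseteq> Restr E W\<^sub>1" "M\<^sub>2 \<subseteq> Restr E W\<^sub>2" using M unfolding orients_def by simp_all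
  have "((u, v) \<in> M\<^sub>1 \<union> M\<^sub>2) \<noteq> ((v, u) \<in> M\<^sub>1 \<union> M\<^sub>2)" if "(u, v) \<in> Restr E W" for u v
  proof -
    consider (first) "(u, v) \<in> Restr E W\<^sub>1" | (second) "(u, v) \<in> Restr E W\<^sub>2"
      using \<open>(u, v) \<in> Restr E W\<close> unfolding glued_Restr[OF glued] by (rule UnE)
    then show ?thesis
    proof cases
      case first
      then have "(u, v) \<notin> M\<^sub>2" "(v, u) \<notin> M\<^sub>2" using disjoint M_sub(2) by auto
      then show ?thesis using first M(1) unfolding orients_def by auto
    next
      case second
      then have "(u, v) \<notin> M\<^sub>1" "(v, u) \<notin> M\<^sub>1" using disjoint M_sub(1) by auto
      then show ?thesis using second M(2) unfolding orients_def by auto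
    qed
  qed
  moreover have "M\<^sub>1 \<union> M\<^sub>2 \<subseteq> Restr E W" using M_sub unfolding glued_Restr[OF glued] by (rule Un_mono)
  ultimately show ?thesis unfolding orients_def by auto
qed

lemma exists_glued:
  assumes "sym E" "strong W E" "W \<noteq> {}" "\<not> nonseparable W E"
  obtains x W\<^sub>1 W\<^sub>2 where "glued W E x W\<^sub>1 W\<^sub>2"
proof -
  obtain x where x: "\<not> strong (W - {x}) E" using assms unfolding nonseparable_def by auto
  then have "x \<in> W" using assms(2) by (metis Diff_empty Diff_insert0)
  obtain S where S: "S \<noteq> {}" "S \<subset> W - {x}" "E \<inter> S \<times> (W - {x} - S) = {}"
    using x by (rule not_strongE)
  have "(a, b) \<notin> E \<and> (b, a) \<notin> E" if "a \<in> S" "b \<in> W - {x} - S" for a b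
    using that S(3) \<open>sym E\<close> by (auto dest: symD)
  then have "glued W E x (insert x S) (W - S)"
    unfolding glued_def using S(1,2) \<open>x \<in> W\<close> by auto
  then show thesis by (rule that)
qed

lemma nonseparable_subset_glued:
  assumes glued: "glued W E x W\<^sub>1 W\<^sub>2" and U: "nonseparable U E" "U \<subseteq> W"
  shows "U \<subseteq> W\<^sub>1 \<or> U \<subseteq> W\<^sub>2"
proof (rule ccontr)
  assume "\<not> ?thesis"
  then obtain a b where ab: "a \<in> U - W\<^sub>1" "b \<in> U - W\<^sub>2" by blast
  have W: "U \<subseteq> W\<^sub>1 \<union> W\<^sub>2" "x \<in> W\<^sub>1" "x \<in> W\<^sub>2" using glued U(2) unfolding glued_def by auto
  let ?S = "U \<inter> W\<^sub>1 - {x}"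
  have "b \<in> ?S" "a \<in> U - {x} - ?S" using ab W by blast+
  then have "?S \<noteq> {}" "?S \<subset> U - {x}" by blast+
  moreover have "strong (U - {x}) E" using U(1) unfolding nonseparable_def by simp
  ultimately obtain c d where cd: "c \<in> ?S" "d \<in> U - {x} - ?S" "(c, d) \<in> E"
    using strong_crossing_arcE[of "U - {x}" E ?S] by metis
  then have "c \<in> W\<^sub>1 - {x}" "d \<in> W\<^sub>2 - {x}" using W(1) by blast+
  then show False using glued_not_adjacent[OF glued] cd(3) by blast
qed

lemma block_sets_nonseparable: "nonseparable W E \<Longrightarrow> block_sets W E = {W}"
  unfolding block_sets_def by auto

lemma finite_block_sets: "finite W \<Longrightarrow> finite (block_sets W E)"
  by (rule finite_subset[of _ "Pow W"]) (auto simp: block_sets_def)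

lemma block_sets_glued_subset:
  assumes "glued W E x W\<^sub>1 W\<^sub>2"
  shows "block_sets W E \<subseteq> block_sets W\<^sub>1 E \<union> block_sets W\<^sub>2 E"
proof
  fix U assume "U \<in> block_sets W E"
  then have U: "U \<subseteq> W" "nonseparable U E" "\<And>U'. U \<subseteq> U' \<Longrightarrow> U' \<subseteq> W \<Longrightarrow> nonseparable U' E \<Longrightarrow> U' = U"
    unfolding block_sets_def by simp_all
  then have "U \<in> block_sets V E" if "U \<subseteq> V" "V \<subseteq> W" for V
    using U that unfolding block_sets_def mem_Collect_eq by (meson subset_trans)
  moreover have "W\<^sub>1 \<subseteq> W" "W\<^sub>2 \<subseteq> W" using assms unfolding glued_def by auto
  moreover have "U \<subseteq> W\<^sub>1 \<or> U \<subseteq> W\<^sub>2" using nonseparable_subset_glued[OF assms] U(1,2) by simp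
  ultimately show "U \<in> block_sets W\<^sub>1 E \<union> block_sets W\<^sub>2 E" by blast
qed

lemma block_count_glued_le:
  assumes "glued W E x W\<^sub>1 W\<^sub>2" "finite W"
  shows "block_count W E \<le> block_count W\<^sub>1 E + block_count W\<^sub>2 E"
proof -
  have "finite W\<^sub>1" "finite W\<^sub>2" using assms unfolding glued_def by auto
  then have "card (block_sets W E) \<le> card (block_sets W\<^sub>1 E \<union> block_sets W\<^sub>2 E)"
    by (simp add: card_mono finite_block_sets block_sets_glued_subset[OF assms(1)])
  also have "\<dots> \<le> card (block_sets W\<^sub>1 E) + card (block_sets W\<^sub>2 E)" by (rule card_Un_le)
  finally show ?thesis unfolding block_count_def .
qed

lemma block_count_pos:
  assumes "finite W" "W \<noteq> {}"
  shows "block_count W E \<ge> 1"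
proof -
  let ?\<U> = "{U. U \<subseteq> W \<and> nonseparable U E}"
  obtain w where "w \<in> W" using assms(2) by blast
  moreover have "nonseparable {w} E" unfolding nonseparable_def strong_def by auto
  ultimately have "{w} \<in> ?\<U>" by simp
  moreover have "finite ?\<U>" using assms(1) by simp
  ultimately obtain U where "U \<in> ?\<U>" "\<forall>U'\<in>?\<U>. U \<subseteq> U' \<longrightarrow> U = U'"
    using finite_has_maximal2[of ?\<U> "{w}"] by auto
  then have "U \<in> block_sets W E" unfolding block_sets_def by auto
  then have "card (block_sets W E) \<noteq> 0" using finite_block_sets[OF assms(1)] by auto
  then show ?thesis unfolding block_count_def by simp
qed

lemma block_count_less:
  assumes "sym E" "two_arc_strong W E" "finite W" "card W \<ge> 2"
  shows "2 * block_count W E < card W"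
  using assms(2-)
proof (induction "card W" arbitrary: W rule: less_induct)
  case less
  show ?case
  proof (cases "nonseparable W E")
    case True
    then show ?thesis
      using two_arc_strong_card_ge_3[OF less.prems(1,3)]
      by (simp add: block_count_def block_sets_nonseparable)
  next
    case False
    moreover have "W \<noteq> {}" using less.prems(3) by auto
    ultimately obtain x W\<^sub>1 W\<^sub>2 where glued: "glued W E x W\<^sub>1 W\<^sub>2"
      using exists_glued[OF \<open>sym E\<close> two_arc_strong_imp_strong[OF less.prems(1)]] by blast
    have parts: "2 * block_count U E < card U" if "glued W E x U U'" for U U'
      using less.hyps glued_card[OF that less.prems(2)] glued_two_arc_strong[OF that less.prems(1)]
      by blast
    have "2 * block_count W\<^sub>1 E < card W\<^sub>1" "2 * block_count W\<^sub>2 E < card W\<^sub>2"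
      using parts[OF glued] parts[OF glued_commute[OF glued]] .
    then show ?thesis
      using glued_card(1)[OF glued less.prems(2)] block_count_glued_le[OF glued less.prems(2)]
      by linarith
  qed
qed

section \<open>Orienting glued parts\<close>

definition short_orientation :: "'a set \<Rightarrow> 'a rel \<Rightarrow> 'a rel \<Rightarrow> bool" where
  "short_orientation W E M \<longleftrightarrow> orients W E M \<and> spare M (card W) (block_count W E div 2 - 1) W W"

text \<open>The induction hypothesis for a part of the graph attached at \<open>s\<close>. The three bounds are tuned to
  each other: the first two sum to one less than the number of blocks, which is the number of blocks
  whose orientation is free to favour one direction, and the weak third bound is compensated by
  the at least two vertices of the other part that are avoided. Subtraction truncates, so a bound
  is \<open>0\<close> when there are too few blocks.\<close>

definition rooted_orientation :: "'a set \<Rightarrow> 'a rel \<Rightarrow> 'a \<Rightarrow> 'a rel \<Rightarrow> bool" where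
  "rooted_orientation W E s M \<longleftrightarrow> orients W E M \<and>
     spare M (card W) ((block_count W E - 1) div 2) {s} W \<and>
     spare M (card W) (block_count W E div 2) W {s} \<and>
     spare M (card W) ((block_count W E - 5) div 2) W W"

definition short_orientable :: "'a set \<Rightarrow> 'a rel \<Rightarrow> bool" where
  "short_orientable W E \<longleftrightarrow>
     (\<exists>M. short_orientation W E M) \<and> (\<forall>s\<in>W. \<exists>M. rooted_orientation W E s M)"

lemma strong_nonseparable_imp_short:
  assumes "orients W E M" "strong W M" "finite W" "nonseparable W E"
  shows "short_orientation W E M" and "s \<in> W \<Longrightarrow> rooted_orientation W E s M"
proof -
  have "M \<subseteq> W \<times> W" using assms(1) unfolding orients_def by auto
  note spare = strong_spare[OF assms(2) this assms(3)]
  have "block_count W E = 1"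
    using assms(4) by (simp add: block_count_def block_sets_nonseparable)
  then show "short_orientation W E M" and "s \<in> W \<Longrightarrow> rooted_orientation W E s M"
    using assms(1) spare unfolding short_orientation_def rooted_orientation_def by simp_all
qed

lemma glued_spare_iff:
  assumes "glued W E x W\<^sub>1 W\<^sub>2"
  shows "spare M n k A W \<longleftrightarrow> spare M n k A W\<^sub>1 \<and> spare M n k A W\<^sub>2"
    and "spare M n k W B \<longleftrightarrow> spare M n k W\<^sub>1 B \<and> spare M n k W\<^sub>2 B"
  using assms unfolding glued_def spare_def by auto

lemma glued_spare_avoid:
  assumes "glued W E x W\<^sub>1 W\<^sub>2" "finite W" "spare M\<^sub>1 (card W\<^sub>1) k A B"
  shows "spare (M\<^sub>1 \<union> M\<^sub>2) (card W) (k + (card W\<^sub>2 - 1)) A B"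
  using assms(3)
  by (rule spare_mono)
    (use glued_card(1)[OF assms(1,2)] glued_card(3)[OF glued_commute[OF assms(1)] assms(2)] in auto)

lemma glued_spare_through:
  assumes "glued W E x W\<^sub>1 W\<^sub>2" "finite W"
    and "spare M\<^sub>1 (card W\<^sub>1) k\<^sub>1 A {x}" "spare M\<^sub>2 (card W\<^sub>2) k\<^sub>2 {x} B"
  shows "spare (M\<^sub>1 \<union> M\<^sub>2) (card W) (k\<^sub>1 + k\<^sub>2) A B"
proof -
  have "spare (M\<^sub>1 \<union> M\<^sub>2) (card W\<^sub>1) k\<^sub>1 A {x}" by (rule spare_mono[OF assms(3)]) auto
  moreover have "spare (M\<^sub>1 \<union> M\<^sub>2) (card W\<^sub>2) k\<^sub>2 {x} B" by (rule spare_mono[OF assms(4)]) auto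
  ultimately have "spare (M\<^sub>1 \<union> M\<^sub>2) (card W\<^sub>1 + card W\<^sub>2 - 1) (k\<^sub>1 + k\<^sub>2) A B" by (rule spare_concat)
  then show ?thesis using glued_card(1)[OF assms(1,2), symmetric] by simp
qed

lemma glued_spare_from:
  assumes glued: "glued W E x W\<^sub>1 W\<^sub>2" "finite W" and M\<^sub>2: "rooted_orientation W\<^sub>2 E x M\<^sub>2"
    and "spare M\<^sub>1 (card W\<^sub>1) i A W\<^sub>1" "k \<le> i + (card W\<^sub>2 - 1)"
    and "spare M\<^sub>1 (card W\<^sub>1) j A {x}" "k \<le> j + (block_count W\<^sub>2 E - 1) div 2"
  shows "spare (M\<^sub>1 \<union> M\<^sub>2) (card W) k A W"
  unfolding glued_spare_iff[OF glued(1)]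
proof
  show "spare (M\<^sub>1 \<union> M\<^sub>2) (card W) k A W\<^sub>1"
    using glued_spare_avoid[OF glued assms(4)] assms(5) by (auto intro: spare_weaken)
  have "spare M\<^sub>2 (card W\<^sub>2) ((block_count W\<^sub>2 E - 1) div 2) {x} W\<^sub>2"
    using M\<^sub>2 unfolding rooted_orientation_def by simp
  then show "spare (M\<^sub>1 \<union> M\<^sub>2) (card W) k A W\<^sub>2"
    using glued_spare_through[OF glued assms(6)] assms(7) by (auto intro: spare_weaken)
qed

lemma glued_spare_to:
  assumes glued: "glued W E x W\<^sub>1 W\<^sub>2" "finite W" and M\<^sub>2: "rooted_orientation W\<^sub>2 E x M\<^sub>2"
    and "spare M\<^sub>1 (card W\<^sub>1) i W\<^sub>1 B" "k \<le> i + (card W\<^sub>2 - 1)"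
    and "spare M\<^sub>1 (card W\<^sub>1) j {x} B" "k \<le> j + block_count W\<^sub>2 E div 2"
  shows "spare (M\<^sub>1 \<union> M\<^sub>2) (card W) k W B"
  unfolding glued_spare_iff[OF glued(1)]
proof
  show "spare (M\<^sub>1 \<union> M\<^sub>2) (card W) k W\<^sub>1 B"
    using glued_spare_avoid[OF glued assms(4)] assms(5) by (auto intro: spare_weaken)
  have "spare M\<^sub>2 (card W\<^sub>2) (block_count W\<^sub>2 E div 2) W\<^sub>2 {x}"
    using M\<^sub>2 unfolding rooted_orientation_def by simp
  then have "spare (M\<^sub>2 \<union> M\<^sub>1) (card W) (block_count W\<^sub>2 E div 2 + j) W\<^sub>2 B"
    using glued_spare_through[OF glued_commute[OF glued(1)] glued(2)] assms(6) by blast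
  then show "spare (M\<^sub>1 \<union> M\<^sub>2) (card W) k W\<^sub>2 B"
    using assms(7) by (auto elim!: spare_mono)
qed

lemma glued_spare_all:
  assumes glued: "glued W E x W\<^sub>1 W\<^sub>2" "finite W" and M\<^sub>2: "rooted_orientation W\<^sub>2 E x M\<^sub>2"
    and "spare M\<^sub>1 (card W\<^sub>1) h W\<^sub>1 W\<^sub>1" "k \<le> h + (card W\<^sub>2 - 1)"
    and "spare M\<^sub>1 (card W\<^sub>1) i W\<^sub>1 {x}" "k \<le> i + (block_count W\<^sub>2 E - 1) div 2"
    and "spare M\<^sub>1 (card W\<^sub>1) j {x} W\<^sub>1" "k \<le> j + block_count W\<^sub>2 E div 2"
    and "k \<le> (block_count W\<^sub>2 E - 5) div 2 + (card W\<^sub>1 - 1)"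
  shows "spare (M\<^sub>1 \<union> M\<^sub>2) (card W) k W W"
proof -
  have "spare (M\<^sub>1 \<union> M\<^sub>2) (card W) k W\<^sub>1 W"
    by (rule glued_spare_from[OF glued M\<^sub>2 assms(4-7)])
  moreover have "spare (M\<^sub>1 \<union> M\<^sub>2) (card W) k W W\<^sub>1"
    by (rule glued_spare_to[OF glued M\<^sub>2 assms(4,5,8,9)])
  moreover have "spare (M\<^sub>1 \<union> M\<^sub>2) (card W) k W\<^sub>2 W\<^sub>2"
  proof -
    have "spare M\<^sub>2 (card W\<^sub>2) ((block_count W\<^sub>2 E - 5) div 2) W\<^sub>2 W\<^sub>2"
      using M\<^sub>2 unfolding rooted_orientation_def by simp
    then have "spare (M\<^sub>2 \<union> M\<^sub>1) (card W) ((block_count W\<^sub>2 E - 5) div 2 + (card W\<^sub>1 - 1)) W\<^sub>2 W\<^sub>2"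
      by (rule glued_spare_avoid[OF glued_commute[OF glued(1)] glued(2)])
    then show ?thesis using assms(10) by (auto elim!: spare_mono)
  qed
  ultimately show ?thesis unfolding glued_spare_iff[OF glued(1)] by blast
qed

locale sym_irrefl_rel =
  fixes E :: "'a rel"
  assumes sym_E: "sym E" and irrefl_E: "irrefl E"
begin

lemma glued_block_count_bounds:
  assumes "glued W E x W\<^sub>1 W\<^sub>2" "two_arc_strong W E" "finite W"
  shows "1 \<le> block_count W\<^sub>1 E" "2 * block_count W\<^sub>1 E < card W\<^sub>1"
proof -
  note W\<^sub>1 = glued_card[OF assms(1,3)]
  then have "W\<^sub>1 \<noteq> {}" by auto
  then show "1 \<le> block_count W\<^sub>1 E" using W\<^sub>1 by (intro block_count_pos)
  show "2 * block_count W\<^sub>1 E < card W\<^sub>1"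
    using block_count_less[OF sym_E glued_two_arc_strong[OF assms(1,2)]] W\<^sub>1 by blast
qed

lemma glued_orientation_at_root:
  assumes glued: "glued W E x W\<^sub>1 W\<^sub>2" "finite W" and "two_arc_strong W E"
    and M: "rooted_orientation W\<^sub>1 E x M\<^sub>1" "rooted_orientation W\<^sub>2 E x M\<^sub>2"
  shows "short_orientation W E (M\<^sub>1 \<union> M\<^sub>2)" "rooted_orientation W E x (M\<^sub>1 \<union> M\<^sub>2)"
proof -
  let ?p = "block_count W E" and ?p\<^sub>1 = "block_count W\<^sub>1 E"
  note counts = block_count_glued_le[OF glued] glued_block_count_bounds[OF glued(1) assms(3) glued(2)]
    glued_block_count_bounds[OF glued_commute[OF glued(1)] assms(3) glued(2)]
  have M\<^sub>1: "spare M\<^sub>1 (card W\<^sub>1) ((?p\<^sub>1 - 1) div 2) {x} W\<^sub>1"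
      "spare M\<^sub>1 (card W\<^sub>1) (?p\<^sub>1 div 2) W\<^sub>1 {x}"
      "spare M\<^sub>1 (card W\<^sub>1) ((?p\<^sub>1 - 5) div 2) W\<^sub>1 W\<^sub>1"
    using M(1) unfolding rooted_orientation_def by simp_all
  have at_x: "spare M\<^sub>1 (card W\<^sub>1) (2 * ?p\<^sub>1) {x} {x}"
    using counts(3) by (rule spare_singleton_self)
  have orients: "orients W E (M\<^sub>1 \<union> M\<^sub>2)"
    using glued_orients[OF glued(1) irrefl_E] M unfolding rooted_orientation_def by simp
  have all: "spare (M\<^sub>1 \<union> M\<^sub>2) (card W) (?p div 2 - 1) W W"
    by (rule glued_spare_all[OF glued M(2) M\<^sub>1(3) _ M\<^sub>1(2) _ M\<^sub>1(1)]) (use counts in auto)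
  then show "short_orientation W E (M\<^sub>1 \<union> M\<^sub>2)" using orients unfolding short_orientation_def by simp
  have "spare (M\<^sub>1 \<union> M\<^sub>2) (card W) ((?p - 1) div 2) {x} W"
    by (rule glued_spare_from[OF glued M(2) M\<^sub>1(1) _ at_x]) (use counts in auto)
  moreover have "spare (M\<^sub>1 \<union> M\<^sub>2) (card W) (?p div 2) W {x}"
    by (rule glued_spare_to[OF glued M(2) M\<^sub>1(2) _ at_x]) (use counts in auto)
  moreover have "spare (M\<^sub>1 \<union> M\<^sub>2) (card W) ((?p - 5) div 2) W W"
    by (rule spare_weaken[OF all]) auto
  ultimately show "rooted_orientation W E x (M\<^sub>1 \<union> M\<^sub>2)"
    using orients unfolding rooted_orientation_def by simp
qed

lemma exists_strong_orientation_spare_split: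
  assumes "two_arc_strong W E" "finite W" "s \<in> W" "x \<in> W" "s \<noteq> x" and "i + j = 1"
  obtains M where "orients W E M" "strong W M"
    "spare M (card W) i {s} {x}" "spare M (card W) j {x} {s}"
proof -
  obtain M where M: "orients W E M" "strong W M"
    and favoured: "i = 1 \<Longrightarrow> spare M (card W) 1 {s} {x}" "j = 1 \<Longrightarrow> spare M (card W) 1 {x} {s}"
  proof (cases "i = 1")
    case True
    then show thesis
      using exists_strong_orientation_spare[OF assms(1) irrefl_E assms(2,3,4,5)] that assms(6) by auto
  next
    case False
    then show thesis
      using exists_strong_orientation_spare[OF assms(1) irrefl_E assms(2,4,3)] that assms(5,6) by auto
  qed
  have "M \<subseteq> W \<times> W" using M(1) unfolding orients_def by auto
  then have "spare M (card W) 0 {s} {x}" "spare M (card W) 0 {x} {s}"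
    using strong_spare[OF M(2) _ assms(2)] assms(3,4) by simp_all
  moreover have "i = 0 \<and> j = 1 \<or> i = 1 \<and> j = 0" using assms(6) by auto
  ultimately show thesis using that[OF M] favoured by auto
qed

text \<open>The root's block favours the direction in which the part attached to it has the weaker bound.\<close>

lemma glued_orientation_nonseparable_root:
  assumes glued: "glued W E x W\<^sub>1 W\<^sub>2" "finite W" and "two_arc_strong W E"
    and s: "s \<in> W\<^sub>1" "s \<noteq> x" and "nonseparable W\<^sub>1 E" and M\<^sub>2: "rooted_orientation W\<^sub>2 E x M\<^sub>2"
  obtains M\<^sub>1 where "rooted_orientation W E s (M\<^sub>1 \<union> M\<^sub>2)"
proof -
  let ?p = "block_count W E" and ?p\<^sub>2 = "block_count W\<^sub>2 E"
  have "block_count W\<^sub>1 E = 1"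
    using assms(6) by (simp add: block_count_def block_sets_nonseparable)
  then have counts: "?p \<le> 1 + ?p\<^sub>2" "1 \<le> ?p\<^sub>2" "2 * ?p\<^sub>2 < card W\<^sub>2" "2 < card W\<^sub>1"
    using block_count_glued_le[OF glued] glued_block_count_bounds[OF glued(1) assms(3) glued(2)]
      glued_block_count_bounds[OF glued_commute[OF glued(1)] assms(3) glued(2)] by auto
  have W\<^sub>1: "two_arc_strong W\<^sub>1 E" "finite W\<^sub>1" "x \<in> W\<^sub>1"
    using glued_two_arc_strong[OF glued(1) assms(3)] glued_card(2)[OF glued] glued(1)
    unfolding glued_def by auto
  define i where "i = Suc ?p\<^sub>2 mod 2"
  have "i + ?p\<^sub>2 mod 2 = 1" unfolding i_def by presburger
  then obtain M\<^sub>1 where M\<^sub>1: "orients W\<^sub>1 E M\<^sub>1" "strong W\<^sub>1 M\<^sub>1"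
    and favoured: "spare M\<^sub>1 (card W\<^sub>1) i {s} {x}" "spare M\<^sub>1 (card W\<^sub>1) (?p\<^sub>2 mod 2) {x} {s}"
    by (rule exists_strong_orientation_spare_split[OF W\<^sub>1(1,2) s(1) W\<^sub>1(3) s(2)])
  have "M\<^sub>1 \<subseteq> W\<^sub>1 \<times> W\<^sub>1" using M\<^sub>1(1) unfolding orients_def by auto
  note within = strong_spare[OF M\<^sub>1(2) this W\<^sub>1(2)]
  have parity: "(?p - 1) div 2 \<le> i + (?p\<^sub>2 - 1) div 2" "?p div 2 \<le> ?p\<^sub>2 mod 2 + ?p\<^sub>2 div 2"
    using counts(1,2) unfolding i_def by (cases "even ?p\<^sub>2"; auto elim!: evenE oddE)+
  have "spare (M\<^sub>1 \<union> M\<^sub>2) (card W) ((?p - 5) div 2) W W"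
    by (rule glued_spare_all[OF glued M\<^sub>2 within _ within _ within]) (use counts W\<^sub>1(3) in auto)
  moreover have "spare (M\<^sub>1 \<union> M\<^sub>2) (card W) ((?p - 1) div 2) {s} W"
    by (rule glued_spare_from[OF glued M\<^sub>2 within _ favoured(1) parity(1)])
      (use counts s(1) in auto)
  moreover have "spare (M\<^sub>1 \<union> M\<^sub>2) (card W) (?p div 2) W {s}"
    by (rule glued_spare_to[OF glued M\<^sub>2 within _ favoured(2) parity(2)])
      (use counts s(1) in auto)
  moreover have "orients W E (M\<^sub>1 \<union> M\<^sub>2)"
    using glued_orients[OF glued(1) irrefl_E M\<^sub>1(1)] M\<^sub>2 unfolding rooted_orientation_def by simp
  ultimately have "rooted_orientation W E s (M\<^sub>1 \<union> M\<^sub>2)"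
    unfolding rooted_orientation_def by simp
  then show thesis by (rule that)
qed

lemma glued_orientation_two_branches:
  assumes glued: "glued W E x W\<^sub>1 W\<^sub>2" "finite W" and glued': "glued W\<^sub>1 E y W\<^sub>0 W\<^sub>3"
    and "two_arc_strong W E" and s: "s \<in> W\<^sub>0" and x: "x \<in> W\<^sub>0"
    and M\<^sub>0: "short_orientation W\<^sub>0 E M\<^sub>0"
    and M\<^sub>2: "rooted_orientation W\<^sub>2 E x M\<^sub>2" and M\<^sub>3: "rooted_orientation W\<^sub>3 E y M\<^sub>3"
  shows "rooted_orientation W E s (M\<^sub>0 \<union> M\<^sub>3 \<union> M\<^sub>2)"
proof -
  let ?p = "block_count W E" and ?p\<^sub>0 = "block_count W\<^sub>0 E"
    and ?p\<^sub>2 = "block_count W\<^sub>2 E" and ?p\<^sub>3 = "block_count W\<^sub>3 E"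
  let ?N = "M\<^sub>0 \<union> M\<^sub>3"
  have W\<^sub>1: "two_arc_strong W\<^sub>1 E" "finite W\<^sub>1"
    using glued_two_arc_strong[OF glued(1) assms(4)] glued_card(2)[OF glued] .
  have y: "y \<in> W\<^sub>0" using glued' unfolding glued_def by auto
  note counts = block_count_glued_le[OF glued] block_count_glued_le[OF glued' W\<^sub>1(2)]
    glued_card(1)[OF glued' W\<^sub>1(2)] glued_block_count_bounds[OF glued' W\<^sub>1]
    glued_block_count_bounds[OF glued_commute[OF glued'] W\<^sub>1]
    glued_block_count_bounds[OF glued_commute[OF glued(1)] assms(4) glued(2)]
  have core: "spare M\<^sub>0 (card W\<^sub>0) (?p\<^sub>0 div 2 - 1) A B" if "A \<subseteq> W\<^sub>0" "B \<subseteq> W\<^sub>0" for A B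
    using M\<^sub>0 that unfolding short_orientation_def by (auto intro: spare_weaken)
  have from_core: "spare ?N (card W\<^sub>1) (?p\<^sub>0 div 2 - 1 + (?p\<^sub>3 - 1) div 2) {v} W\<^sub>1" if "v \<in> W\<^sub>0" for v
    by (rule glued_spare_from[OF glued' W\<^sub>1(2) M\<^sub>3 core _ core]) (use counts y that in auto)
  have to_core: "spare ?N (card W\<^sub>1) (?p\<^sub>0 div 2 - 1 + ?p\<^sub>3 div 2) W\<^sub>1 {v}" if "v \<in> W\<^sub>0" for v
    by (rule glued_spare_to[OF glued' W\<^sub>1(2) M\<^sub>3 core _ core]) (use counts y that in auto)
  have within_core: "spare ?N (card W\<^sub>1) (?p\<^sub>0 div 2 - 1 + 2 * ?p\<^sub>3) {u} {v}"
    if "u \<in> W\<^sub>0" "v \<in> W\<^sub>0" for u v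
    by (rule spare_weaken[OF glued_spare_avoid[OF glued' W\<^sub>1(2) core]]) (use counts that in auto)
  have all: "spare ?N (card W\<^sub>1) ((?p\<^sub>0 + ?p\<^sub>3 - 5) div 2) W\<^sub>1 W\<^sub>1"
    by (rule glued_spare_all[OF glued' W\<^sub>1(2) M\<^sub>3 core _ core _ core]) (use counts y in auto)
  have "spare (?N \<union> M\<^sub>2) (card W) ((?p - 5) div 2) W W"
    by (rule glued_spare_all[OF glued M\<^sub>2 all _ to_core _ from_core]) (use counts x in auto)
  moreover have "spare (?N \<union> M\<^sub>2) (card W) ((?p - 1) div 2) {s} W"
    by (rule glued_spare_from[OF glued M\<^sub>2 from_core _ within_core]) (use counts s x in auto)
  moreover have "spare (?N \<union> M\<^sub>2) (card W) (?p div 2) W {s}"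
    by (rule glued_spare_to[OF glued M\<^sub>2 to_core _ within_core]) (use counts s x in auto)
  moreover have "orients W E (?N \<union> M\<^sub>2)"
    using glued_orients[OF glued(1) irrefl_E] glued_orients[OF glued' irrefl_E] M\<^sub>0 M\<^sub>2 M\<^sub>3
    unfolding short_orientation_def rooted_orientation_def by simp
  ultimately show ?thesis unfolding rooted_orientation_def by simp
qed

lemma exists_glued_around:
  assumes "strong W E" "\<not> nonseparable W E" "s \<in> W"
  obtains x W\<^sub>1 W\<^sub>2 where "glued W E x W\<^sub>1 W\<^sub>2" "s \<in> W\<^sub>1"
proof -
  have "W \<noteq> {}" using assms(3) by blast
  then obtain x U U' where glued: "glued W E x U U'"
    using exists_glued[OF sym_E assms(1) _ assms(2)] by metis
  then have "s \<in> U \<or> s \<in> U'" using assms(3) unfolding glued_def by simp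
  then show thesis using that[OF glued] that[OF glued_commute[OF glued]] by blast
qed

text \<open>For a root \<open>s\<close> that is not a cut vertex, a smallest part \<open>W\<^sub>1\<close> around \<open>s\<close> is split off. If it is
  separable, minimality forces its pieces away from \<open>s\<close> to be attached beside \<open>W\<^sub>2\<close>, and every
  walk from \<open>s\<close> avoids one of the two branches.\<close>

lemma exists_nonseparable_part_or_two_branches:
  assumes "strong W E" "finite W" "\<not> nonseparable W E" "s \<in> W"
    and not_cut: "\<And>U U'. \<not> glued W E s U U'"
  obtains (nonseparable_part) x W\<^sub>1 W\<^sub>2 where
      "glued W E x W\<^sub>1 W\<^sub>2" "s \<in> W\<^sub>1" "s \<noteq> x" "nonseparable W\<^sub>1 E"
    | (two_branches) x y W\<^sub>0 W\<^sub>1 W\<^sub>2 W\<^sub>3 where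
      "glued W E x W\<^sub>1 W\<^sub>2" "glued W\<^sub>1 E y W\<^sub>0 W\<^sub>3" "s \<in> W\<^sub>0" "x \<in> W\<^sub>0"
proof -
  let ?P = "\<lambda>U. s \<in> U \<and> (\<exists>x U'. glued W E x U U')"
  obtain x U U' where "glued W E x U U'" "s \<in> U"
    by (rule exists_glued_around[OF assms(1,3,4)])
  then have "?P U" by blast
  then obtain W\<^sub>1 where "?P W\<^sub>1" and minimal: "\<And>U. ?P U \<Longrightarrow> card W\<^sub>1 \<le> card U"
    using ex_has_least_nat[of ?P U card] by auto
  then obtain x W\<^sub>2 where glued: "glued W E x W\<^sub>1 W\<^sub>2" and "s \<in> W\<^sub>1" by blast
  show thesis
  proof (cases "nonseparable W\<^sub>1 E")
    case True
    have "s \<noteq> x" using glued not_cut by blast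
    then show thesis using nonseparable_part[OF glued \<open>s \<in> W\<^sub>1\<close>] True by blast
  next
    case False
    then obtain y W\<^sub>0 W\<^sub>3 where glued': "glued W\<^sub>1 E y W\<^sub>0 W\<^sub>3" and "s \<in> W\<^sub>0"
      using exists_glued_around[OF glued_strong[OF glued assms(1)] _ \<open>s \<in> W\<^sub>1\<close>] by metis
    have "x \<in> W\<^sub>0"
    proof (rule ccontr)
      assume "x \<notin> W\<^sub>0"
      then have "x \<in> W\<^sub>3" using glued glued' unfolding glued_def by auto
      then have "glued W E y W\<^sub>0 (W\<^sub>3 \<union> W\<^sub>2)" by (rule glued_assoc[OF glued glued'])
      then have "card W\<^sub>1 \<le> card W\<^sub>0" using minimal \<open>s \<in> W\<^sub>0\<close> by blast
      moreover have "card W\<^sub>0 < card W\<^sub>1"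
        using glued_card(4)[OF glued'] glued_card(2)[OF glued assms(2)] by blast
      ultimately show False by linarith
    qed
    then show thesis using two_branches[OF glued glued' \<open>s \<in> W\<^sub>0\<close>] by blast
  qed
qed

lemma glued_short_orientable:
  assumes "glued W E x W\<^sub>1 W\<^sub>2" "two_arc_strong W E" "finite W"
    and smaller: "\<And>U. two_arc_strong U E \<Longrightarrow> finite U \<Longrightarrow> U \<noteq> {} \<Longrightarrow> card U < card W \<Longrightarrow>
      short_orientable U E"
  shows "short_orientable W\<^sub>1 E"
proof (rule smaller)
  show "two_arc_strong W\<^sub>1 E" by (rule glued_two_arc_strong[OF assms(1,2)])
  show "finite W\<^sub>1" "card W\<^sub>1 < card W" by (rule glued_card[OF assms(1,3)])+
  show "W\<^sub>1 \<noteq> {}" using assms(1) unfolding glued_def by auto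
qed

lemma exists_rooted_orientation_not_cut:
  assumes W: "two_arc_strong W E" "finite W" and "\<not> nonseparable W E" "s \<in> W"
    and not_cut: "\<And>U U'. \<not> glued W E s U U'"
    and smaller: "\<And>U. two_arc_strong U E \<Longrightarrow> finite U \<Longrightarrow> U \<noteq> {} \<Longrightarrow> card U < card W \<Longrightarrow>
      short_orientable U E"
  shows "\<exists>M. rooted_orientation W E s M"
  using two_arc_strong_imp_strong[OF W(1)] W(2) assms(3,4) not_cut
proof (cases rule: exists_nonseparable_part_or_two_branches)
  case (nonseparable_part x W\<^sub>1 W\<^sub>2)
  have "x \<in> W\<^sub>2" using nonseparable_part(1) unfolding glued_def by auto
  then obtain M\<^sub>2 where M\<^sub>2: "rooted_orientation W\<^sub>2 E x M\<^sub>2"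
    using glued_short_orientable[OF glued_commute[OF nonseparable_part(1)] W smaller]
    unfolding short_orientable_def by blast
  obtain M\<^sub>1 where "rooted_orientation W E s (M\<^sub>1 \<union> M\<^sub>2)"
    by (rule glued_orientation_nonseparable_root
        [OF nonseparable_part(1) W(2,1) nonseparable_part(2-4) M\<^sub>2])
  then show ?thesis by blast
next
  case (two_branches x y W\<^sub>0 W\<^sub>1 W\<^sub>2 W\<^sub>3)
  have W\<^sub>1: "two_arc_strong W\<^sub>1 E" "finite W\<^sub>1" "card W\<^sub>1 < card W"
    using glued_two_arc_strong[OF two_branches(1) W(1)] glued_card[OF two_branches(1) W(2)]
    by simp_all
  have smaller\<^sub>1: "short_orientable U E"
    if "two_arc_strong U E" "finite U" "U \<noteq> {}" "card U < card W\<^sub>1" for U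
    using that W\<^sub>1(3) by (intro smaller) auto
  have "x \<in> W\<^sub>2" using two_branches(1) unfolding glued_def by auto
  then obtain M\<^sub>2 where M\<^sub>2: "rooted_orientation W\<^sub>2 E x M\<^sub>2"
    using glued_short_orientable[OF glued_commute[OF two_branches(1)] W smaller]
    unfolding short_orientable_def by blast
  have "y \<in> W\<^sub>3" using two_branches(2) unfolding glued_def by auto
  then obtain M\<^sub>3 where M\<^sub>3: "rooted_orientation W\<^sub>3 E y M\<^sub>3"
    using glued_short_orientable[OF glued_commute[OF two_branches(2)] W\<^sub>1(1,2) smaller\<^sub>1]
    unfolding short_orientable_def by blast
  obtain M\<^sub>0 where M\<^sub>0: "short_orientation W\<^sub>0 E M\<^sub>0"
    using glued_short_orientable[OF two_branches(2) W\<^sub>1(1,2) smaller\<^sub>1]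
    unfolding short_orientable_def by blast
  show ?thesis
    using glued_orientation_two_branches
      [OF two_branches(1) W(2) two_branches(2) W(1) two_branches(3,4) M\<^sub>0 M\<^sub>2 M\<^sub>3] by blast
qed

lemma two_arc_strong_imp_short_orientable:
  assumes "two_arc_strong W E" "finite W" "W \<noteq> {}"
  shows "short_orientable W E"
  using assms
proof (induction "card W" arbitrary: W rule: less_induct)
  case less
  note W = less.prems(1,2)
  have smaller: "short_orientable U E"
    if "two_arc_strong U E" "finite U" "U \<noteq> {}" "card U < card W" for U
    using less.hyps[OF that(4,1-3)] .
  show ?case
  proof (cases "nonseparable W E")
    case True
    obtain M where "orients W E M" "strong W M"
      by (rule exists_strong_orientation[OF W(1) irrefl_E W(2)])
    then show ?thesis
      using strong_nonseparable_imp_short W(2) True unfolding short_orientable_def by metis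
  next
    case False
    have at_cut_vertex: "(\<exists>M. short_orientation W E M) \<and> (\<exists>M. rooted_orientation W E x M)"
      if glued: "glued W E x U U'" for x U U'
    proof -
      have "x \<in> U" "x \<in> U'" using glued unfolding glued_def by auto
      then obtain M M' where "rooted_orientation U E x M" "rooted_orientation U' E x M'"
        using glued_short_orientable[OF glued W smaller]
          glued_short_orientable[OF glued_commute[OF glued] W smaller]
        unfolding short_orientable_def by blast
      then show ?thesis using glued_orientation_at_root[OF glued W(2,1)] by blast
    qed
    obtain x U U' where "glued W E x U U'"
      by (rule exists_glued[OF sym_E two_arc_strong_imp_strong[OF W(1)] less.prems(3) False])
    then have "\<exists>M. short_orientation W E M" using at_cut_vertex by blast
    moreover have "\<exists>M. rooted_orientation W E s M" if "s \<in> W" for s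
      using at_cut_vertex exists_rooted_orientation_not_cut[OF W False that _ smaller] by blast
    ultimately show ?thesis unfolding short_orientable_def by blast
  qed
qed

end

section \<open>Blocks of graphs\<close>

definition nonseparable_graph :: "('a, 'b) pre_digraph \<Rightarrow> bool" where
  "nonseparable_graph G \<longleftrightarrow> symmetric G \<and> connected G \<and> (\<forall>v. \<not> cut_vertex G v)"

lemma strongly_connected_iff_strong:
  "strongly_connected G \<longleftrightarrow> verts G \<noteq> {} \<and> strong (verts G) (arcs_ends G)"
  unfolding strongly_connected_def strong_def reachable_def ..

lemma (in wf_digraph) connected_iff_strong:
  assumes "symmetric G"
  shows "connected G \<longleftrightarrow> verts G \<noteq> {} \<and> strong (verts G) (arcs_ends G)"
proof -
  have "connected G \<longleftrightarrow> strongly_connected G"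
    unfolding connected_def strongly_connected_def
    using reachable_mk_symmetric_eq[OF assms] by simp
  then show ?thesis using strongly_connected_iff_strong by blast
qed

lemma (in wf_digraph) not_cut_vertex_iff_strong:
  assumes "symmetric G" "strong (verts G) (arcs_ends G)"
  shows "\<not> cut_vertex G v \<longleftrightarrow> strong (verts G - {v}) (arcs_ends G)"
proof -
  have arcs: "arcs_ends (del_vert v) = Restr (arcs_ends G) (- {v})"
    unfolding arcs_ends_conv del_vert_simps by auto
  have "symmetric (del_vert v)"
    using assms(1) unfolding symmetric_def arcs sym_def by blast
  then have "connected (del_vert v) \<longleftrightarrow>
      verts G - {v} \<noteq> {} \<and> strong (verts G - {v}) (arcs_ends (del_vert v))"
    using wf_digraph.connected_iff_strong[OF wf_digraph_del_vert] by (simp add: verts_del_vert)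
  moreover have "strong (verts G - {v}) (arcs_ends (del_vert v)) \<longleftrightarrow>
      strong (verts G - {v}) (arcs_ends G)"
    unfolding arcs by (rule strong_cong) auto
  moreover have "strong (verts G - {v}) (arcs_ends G)" if "v \<notin> verts G \<or> verts G - {v} = {}"
    using that assms(2) by (auto simp: strong_def)
  ultimately show ?thesis unfolding cut_vertex_def verts_del_vert by blast
qed

lemma (in wf_digraph) nonseparable_graph_iff:
  assumes "symmetric G"
  shows "nonseparable_graph G \<longleftrightarrow> nonseparable (verts G) (arcs_ends G)"
  using connected_iff_strong[OF assms] not_cut_vertex_iff_strong[OF assms] assms
  unfolding nonseparable_graph_def nonseparable_def by auto

lemma nonseparable_verts_subgraph:
  assumes "subgraph H G" "nonseparable_graph H"
  shows "nonseparable (verts H) (arcs_ends G)"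
proof -
  interpret H: wf_digraph H using assms(1) by blast
  have "nonseparable (verts H) (arcs_ends H)"
    using assms(2) H.nonseparable_graph_iff unfolding nonseparable_graph_def by blast
  then show ?thesis
    by (rule nonseparable_mono) (use arcs_ends_mono[OF assms(1)] in auto)
qed

lemma (in sym_digraph) nonseparable_graph_induce_subgraph:
  assumes "nonseparable U (arcs_ends G)"
  shows "nonseparable_graph (G \<restriction> U)"
proof -
  interpret H: wf_digraph "G \<restriction> U" by (rule wellformed_induce_subgraph)
  have arcs: "arcs_ends (G \<restriction> U) = Restr (arcs_ends G) U"
    by (auto simp: arcs_ends_conv)
  have "symmetric (G \<restriction> U)"
    using sym_arcs unfolding symmetric_def arcs sym_def by blast
  moreover have "nonseparable U (Restr (arcs_ends G) U)"
    using assms by (rule nonseparable_mono) auto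
  ultimately show ?thesis using H.nonseparable_graph_iff arcs by simp
qed

context sym_digraph
begin

lemma block_eq_induce_subgraph:
  assumes B: "B \<in> blocks G" and U: "verts B \<subseteq> U" "U \<subseteq> verts G" "nonseparable U (arcs_ends G)"
  shows "G \<restriction> U = B"
proof (rule ccontr)
  assume "G \<restriction> U \<noteq> B"
  have "subgraph B G" and max: "\<And>H. H \<noteq> B \<Longrightarrow> subgraph B H \<Longrightarrow> subgraph H G \<Longrightarrow> \<not> nonseparable_graph H"
    using B unfolding blocks_def max_subgraph_def nonseparable_graph_def by blast+
  then have "subgraph B (G \<restriction> U)"
    using U(1) wellformed_induce_subgraph unfolding subgraph_def compatible_def
    by (auto dest: wf_digraph.head_in_verts wf_digraph.tail_in_verts)
  moreover have "subgraph (G \<restriction> U) G" using U(2) by (rule subgraph_induce_subgraphI)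
  ultimately show False
    using max \<open>G \<restriction> U \<noteq> B\<close> nonseparable_graph_induce_subgraph[OF U(3)] by blast
qed

lemma verts_block_in_block_sets:
  assumes "B \<in> blocks G"
  shows "verts B \<in> block_sets (verts G) (arcs_ends G)"
proof -
  have "subgraph B G" "nonseparable_graph B"
    using assms unfolding blocks_def max_subgraph_def nonseparable_graph_def by blast+
  then have "verts B \<subseteq> verts G" "nonseparable (verts B) (arcs_ends G)"
    using nonseparable_verts_subgraph by blast+
  moreover have "U = verts B" if "verts B \<subseteq> U" "U \<subseteq> verts G" "nonseparable U (arcs_ends G)" for U
    using block_eq_induce_subgraph[OF assms that] induce_subgraph_verts by metis
  ultimately show ?thesis unfolding block_sets_def by blast
qed

lemma inj_on_verts_blocks: "inj_on verts (blocks G)"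
proof (rule inj_onI)
  have "G \<restriction> verts B = B" if "B \<in> blocks G" for B
    using block_eq_induce_subgraph[OF that order_refl] verts_block_in_block_sets[OF that]
    unfolding block_sets_def by simp
  then show "B = B'" if "B \<in> blocks G" "B' \<in> blocks G" "verts B = verts B'" for B B'
    using that by metis
qed

end

lemma (in graph) card_blocks_le: "card (blocks G) \<le> block_count (verts G) (arcs_ends G)"
  unfolding block_count_def
  using inj_on_verts_blocks verts_block_in_block_sets
  by (intro card_inj_on_le[of verts]) (auto simp: finite_block_sets)

lemma (in sym_digraph) bridgeless_imp_two_arc_strong:
  assumes "bridgeless G"
  shows "two_arc_strong (verts G) (arcs_ends G)"
  unfolding two_arc_strong_def
proof
  fix e :: "'a \<times> 'a"
  show "strong (verts G) (arcs_ends G - {e})"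
  proof (cases "e \<in> arcs_ends G")
    case False
    then show ?thesis
      using assms connected_iff_strong[OF sym_arcs] unfolding bridgeless_def by simp
  next
    case True
    obtain a b where e: "e = (a, b)" by (cases e)
    let ?H = "del_edge G a b"
    have H: "verts ?H = verts G" "arcs_ends ?H = arcs_ends G - {(a, b), (b, a)}"
      unfolding del_edge_def arcs_ends_def arc_to_ends_def by auto
    interpret H: wf_digraph ?H unfolding del_edge_def by unfold_locales auto
    have "symmetric ?H" using sym_arcs unfolding symmetric_def H sym_def by blast
    moreover have "connected ?H"
      using assms True e unfolding bridgeless_def bridge_def by blast
    ultimately have "strong (verts G) (arcs_ends G - {(a, b), (b, a)})"
      using H.connected_iff_strong H by simp
    then show ?thesis by (rule strong_mono) (use e in auto)
  qed
qed

section \<open>Oriented diameter\<close>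

definition restrict_arcs :: "('a, 'b) pre_digraph \<Rightarrow> 'a rel \<Rightarrow> ('a, 'b) pre_digraph" where
  "restrict_arcs G M = G\<lparr>arcs := {a \<in> arcs G. arc_to_ends G a \<in> M}\<rparr>"

lemma verts_restrict_arcs [simp]: "verts (restrict_arcs G M) = verts G"
  unfolding restrict_arcs_def by simp

lemma arcs_ends_restrict_arcs: "M \<subseteq> arcs_ends G \<Longrightarrow> arcs_ends (restrict_arcs G M) = M"
  unfolding restrict_arcs_def arcs_ends_def arc_to_ends_def by auto

lemma (in wf_digraph) wf_digraph_restrict_arcs: "wf_digraph (restrict_arcs G M)"
  unfolding restrict_arcs_def by unfold_locales auto

lemma (in wf_digraph) orientation_restrict_arcs:
  assumes "orients (verts G) (arcs_ends G) M"
  shows "orientation (restrict_arcs G M) G"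
proof -
  have "subgraph (restrict_arcs G M) G"
    using wf_digraph_restrict_arcs[of M] wf_digraph
    unfolding subgraph_def compatible_def by (auto simp: restrict_arcs_def)
  moreover have "M \<subseteq> arcs_ends G" using assms unfolding orients_def by auto
  moreover have "((u, v) \<in> M) \<noteq> ((v, u) \<in> M)" if "u \<rightarrow> v" for u v
  proof -
    have "(u, v) \<in> Restr (arcs_ends G) (verts G)" using that adj_in_verts by simp
    then show ?thesis using assms unfolding orients_def by blast
  qed
  ultimately show ?thesis
    unfolding orientation_def spanning_def by (simp add: arcs_ends_restrict_arcs)
qed

lemma (in wf_digraph) relpow_imp_awalk:
  assumes "(u, v) \<in> arcs_ends G ^^ j" "u \<in> verts G"
  obtains p where "awalk u p v" "awalk_cost (\<lambda>_. 1) p = real j"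
proof -
  have "\<exists>p. awalk u p v \<and> awalk_cost (\<lambda>_. 1) p = real j"
    using assms(1)
  proof (induction j arbitrary: v)
    case 0
    then show ?case using assms(2) by (auto simp: awalk_Nil_iff intro!: exI[of _ "[]"])
  next
    case (Suc j)
    then obtain w where w: "(u, w) \<in> arcs_ends G ^^ j" "w \<rightarrow> v" by auto
    obtain p where p: "awalk u p w" "awalk_cost (\<lambda>_. 1) p = real j" using Suc.IH w by blast
    obtain e where e: "e \<in> arcs G" "tail G e = w" "head G e = v" using w(2) by (rule reachableE)
    have "awalk w [e] v" using e arc_implies_awalk by blast
    then have "awalk u (p @ [e]) v" using p awalk_appendI by blast
    then show ?case using p by (intro exI[of _ "p @ [e]"]) auto
  qed
  then show thesis using that by blast
qed

lemma (in wf_digraph) diameter_le: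
  assumes "\<And>u v. u \<in> verts G \<Longrightarrow> v \<in> verts G \<Longrightarrow> \<exists>j. (u, v) \<in> arcs_ends G ^^ j \<and> real j \<le> d"
  shows "diameter G \<le> ereal d"
  unfolding diameter_def
proof (rule SUP_least, clarify)
  fix u v assume uv: "u \<in> verts G" "v \<in> verts G"
  then obtain j where "(u, v) \<in> arcs_ends G ^^ j" "real j \<le> d" using assms by blast
  then obtain p where "awalk u p v" "awalk_cost (\<lambda>_. 1) p \<le> d"
    using relpow_imp_awalk uv(1) by metis
  then show "\<mu> (\<lambda>_. 1) u v \<le> ereal d"
    using min_cost_le_walk_cost by (meson ereal_less_eq(3) order_trans)
qed

lemma (in wf_digraph) oriented_diameter_le:
  assumes M: "orients (verts G) (arcs_ends G) M" and "verts G \<noteq> {}"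
    and dist: "\<And>u v. u \<in> verts G \<Longrightarrow> v \<in> verts G \<Longrightarrow> \<exists>j. (u, v) \<in> M ^^ j \<and> real j \<le> d"
  shows "oriented_diameter G \<le> ereal d"
proof -
  let ?D = "restrict_arcs G M"
  interpret D: wf_digraph ?D by (rule wf_digraph_restrict_arcs)
  have D: "arcs_ends ?D = M"
    using M unfolding orients_def by (intro arcs_ends_restrict_arcs) auto
  have "u \<rightarrow>\<^sup>*\<^bsub>?D\<^esub> v" if uv: "u \<in> verts G" "v \<in> verts G" for u v
  proof -
    have "(u, v) \<in> M\<^sup>*" using dist[OF uv] by (blast intro: relpow_imp_rtrancl)
    then show ?thesis using D.reachable_conv'[of u v] uv D by simp
  qed
  then have "strongly_connected ?D" using \<open>verts G \<noteq> {}\<close> unfolding strongly_connected_def by simp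
  then have "oriented_diameter G \<le> diameter ?D"
    unfolding oriented_diameter_def using orientation_restrict_arcs[OF M] by (intro INF_lower) simp
  also have "\<dots> \<le> ereal d"
    using dist D by (intro D.diameter_le) simp
  finally show ?thesis .
qed

theorem theorem1:
  fixes G :: "('a,'b) pre_digraph" and n p :: nat
  assumes "graph G"
    and "bridgeless G"
    and "card (verts G) = n"
    and "card (blocks G) = p"
  shows "oriented_diameter G \<le> ereal (real n - real_of_int \<lfloor>real p / 2\<rfloor>)"
proof -
  interpret graph G by (rule assms(1))
  interpret sym_irrefl_rel "arcs_ends G"
    by unfold_locales (use sym_arcs adj_not_same in \<open>auto simp: symmetric_def irrefl_def\<close>)
  let ?q = "block_count (verts G) (arcs_ends G)"
  have nonempty: "verts G \<noteq> {}"
    using assms(2) connected_iff_strong[OF sym_arcs] unfolding bridgeless_def by blast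
  then obtain M where M: "short_orientation (verts G) (arcs_ends G) M"
    using two_arc_strong_imp_short_orientable[OF bridgeless_imp_two_arc_strong[OF assms(2)]]
    unfolding short_orientable_def by auto
  show ?thesis
  proof (rule oriented_diameter_le[OF _ nonempty])
    show "orients (verts G) (arcs_ends G) M" using M unfolding short_orientation_def by blast
    fix u v assume "u \<in> verts G" "v \<in> verts G"
    then obtain j where j: "(u, v) \<in> M ^^ j" "j + (?q div 2 - 1) < n"
      using M assms(3) unfolding short_orientation_def spare_def by blast
    moreover have "p div 2 \<le> ?q div 2" using card_blocks_le assms(4) by (simp add: div_le_mono)
    ultimately have "j + p div 2 \<le> n" by linarith
    moreover have "\<lfloor>real p / 2\<rfloor> = int (p div 2)" using floor_divide_of_nat_eq[of p 2] by simp
    ultimately show "\<exists>j. (u, v) \<in> M ^^ j \<and> real j \<le> real n - real_of_int \<lfloor>real p / 2\<rfloor>"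
      using j(1) by (intro exI[of _ j]) auto
  qed
qed

end
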